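(* The class $\mathfrak{R}$ of all systems of orthonormal polynomials on the real line with $p_0=1$ and positive leading coefficients is strictly contained in the class $\mathfrak{K}$ of all systems of polynomials associated to Jacobi-type pencils: $\mathfrak{R}\subseteq\mathfrak{K}$ and $\mathfrak{R}\neq\mathfrak{K}$.
   Context: $\mathbb{Z}_+$ denotes the set of non-negative integers. A Jacobi-type pencil is a set $\Theta=(J_3,J_5,\alpha,\beta)$, where $\alpha>0$, $\beta\in\mathbb{R}$, $J_3$ is a semi-infinite Jacobi matrix (real symmetric tridiagonal, with diagonal entries $b_k\in\mathbb{R}$ and off-diagonal entries $a_k>0$, $k\in\mathbb{Z}_+$), and $J_5$ is a semi-infinite real symmetric five-diagonal matrix with diagonal entries $\alpha_n\in\mathbb{R}$, first subdiagonal entries $\beta_n\in\mathbb{R}$ and second subdiagonal entries $\gamma_n>0$, $n\in\mathbb{Z}_+$. The system of polynomials associated to $\Theta$ is the system $\{p_n(\lambda)\}_{n=0}^\infty$ such that $p_0(\lambda)=1$, $p_1(\lambda)=\alpha\lambda+\beta$ and $(J_5-\lambda J_3)(p_0(\lambda),p_1(\lambda),p_2(\lambda),\dots)^T=0$; in scalar form, $$\gamma_{n-2}p_{n-2}(\lambda)+(\beta_{n-1}-\lambda a_{n-1})p_{n-1}(\lambda)+(\alpha_n-\lambda b_n)p_n(\lambda)+(\beta_n-\lambda a_n)p_{n+1}(\lambda)+\gamma_n p_{n+2}(\lambda)=0,\quad n\in\mathbb{Z}_+,$$ where terms containing $p_{-2}=p_{-1}=0$ are omitted. These conditions determine the system uniquely.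 $\mathfrak{K}$ is the class of all systems $\{p_n\}_{n=0}^\infty$ obtained in this way from all Jacobi-type pencils. A system of orthonormal polynomials on the real line is a sequence $\{p_n\}_{n=0}^\infty$ of real polynomials with $\deg p_n=n$ such that $\int_{\mathbb{R}}p_n p_m\,d\sigma=\delta_{n,m}$ for all $n,m\in\mathbb{Z}_+$, for some non-negative Borel measure $\sigma$ on $\mathbb{R}$ with all moments finite. $\mathfrak{R}$ is the class of all such systems with $p_0=1$ and all leading coefficients positive. *)

theory Defs
  imports "HOL-Analysis.Analysis" "HOL-Computational_Algebra.Polynomial"
begin

type_synonym 'a inf_matrix = "nat \<Rightarrow> nat \<Rightarrow> 'a"

definition is_symmetric :: "'a inf_matrix \<Rightarrow> bool" where
  "is_symmetric A \<longleftrightarrow> (\<forall>i j. A i j = A j i)"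

text \<open>Half-bandwidth \<open>w\<close>: \<open>w = 1\<close> is tridiagonal, \<open>w = 2\<close> is five-diagonal.\<close>

definition is_banded :: "nat \<Rightarrow> 'a::zero inf_matrix \<Rightarrow> bool" where
  "is_banded w A \<longleftrightarrow> (\<forall>i j. i + w < j \<or> j + w < i \<longrightarrow> A i j = 0)"

definition jacobi_matrix :: "real inf_matrix \<Rightarrow> bool" where
  "jacobi_matrix A \<longleftrightarrow> is_symmetric A \<and> is_banded 1 A \<and> (\<forall>k. A k (k + 1) > 0)"

definition five_diagonal_matrix :: "real inf_matrix \<Rightarrow> bool" where
  "five_diagonal_matrix A \<longleftrightarrow> is_symmetric A \<and> is_banded 2 A \<and> (\<forall>n. A n (n + 2) > 0)"

record pencil =
  J3 :: "real inf_matrix"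
  J5 :: "real inf_matrix"
  alpha :: real
  beta :: real

definition jacobi_type_pencil :: "pencil \<Rightarrow> bool" where
  "jacobi_type_pencil \<Theta> \<longleftrightarrow>
     jacobi_matrix (J3 \<Theta>) \<and> five_diagonal_matrix (J5 \<Theta>) \<and> alpha \<Theta> > 0"

text \<open>Matrix times column vector; meaningful when every row of \<open>A\<close> has finite support,
  which is the case for banded matrices.\<close>

definition matrix_vector :: "'a::comm_ring_1 inf_matrix \<Rightarrow> (nat \<Rightarrow> 'a) \<Rightarrow> nat \<Rightarrow> 'a" where
  "matrix_vector A v i = (\<Sum>j | A i j \<noteq> 0. A i j * v j)"

text \<open>\<open>J5 - \<lambda> J3\<close> as a matrix over the polynomial ring, the indeterminate being \<open>\<lambda> = [:0, 1:]\<close>.\<close>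

definition pencil_matrix :: "pencil \<Rightarrow> real poly inf_matrix" where
  "pencil_matrix \<Theta> i j = [:J5 \<Theta> i j:] - [:0, 1:] * [:J3 \<Theta> i j:]"

definition associated_system :: "pencil \<Rightarrow> (nat \<Rightarrow> real poly) \<Rightarrow> bool" where
  "associated_system \<Theta> p \<longleftrightarrow>
     p 0 = 1 \<and> p 1 = [:beta \<Theta>, alpha \<Theta>:] \<and>
     (\<forall>n. matrix_vector (pencil_matrix \<Theta>) p n = 0)"

definition class_K :: "(nat \<Rightarrow> real poly) set" where
  "class_K = {p. \<exists>\<Theta>. jacobi_type_pencil \<Theta> \<and> associated_system \<Theta> p}"

definition orthonormal_wrt :: "real measure \<Rightarrow> (nat \<Rightarrow> real poly) \<Rightarrow> bool" where
  "orthonormal_wrt \<sigma> p \<longleftrightarrow>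
     (\<forall>n m. (\<integral>x. poly (p n) x * poly (p m) x \<partial>\<sigma>) = (if n = m then 1 else 0))"

definition orthonormal_polynomials :: "(nat \<Rightarrow> real poly) \<Rightarrow> bool" where
  "orthonormal_polynomials p \<longleftrightarrow>
     (\<forall>n. degree (p n) = n) \<and>
     (\<exists>\<sigma>::real measure. sets \<sigma> = sets borel \<and>
        (\<forall>k. integrable \<sigma> (\<lambda>x. x ^ k)) \<and> orthonormal_wrt \<sigma> p)"

definition class_R :: "(nat \<Rightarrow> real poly) set" where
  "class_R = {p. orthonormal_polynomials p \<and> p 0 = 1 \<and> (\<forall>n. lead_coeff (p n) > 0)}"

lemma matrix_vector_pencil:
  assumes "jacobi_type_pencil \<Theta>"
  shows "matrix_vector (pencil_matrix \<Theta>) p n =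
    (if n \<ge> 2 then [:J5 \<Theta> n (n - 2):] * p (n - 2) else 0) +
    (if n \<ge> 1 then [:J5 \<Theta> n (n - 1), - J3 \<Theta> n (n - 1):] * p (n - 1) else 0) +
    [:J5 \<Theta> n n, - J3 \<Theta> n n:] * p n +
    [:J5 \<Theta> n (n + 1), - J3 \<Theta> n (n + 1):] * p (n + 1) +
    [:J5 \<Theta> n (n + 2):] * p (n + 2)"
proof -
  have b3: "J3 \<Theta> n j = 0" if "n + 1 < j \<or> j + 1 < n" for j
    using assms that by (auto simp: jacobi_type_pencil_def jacobi_matrix_def is_banded_def)
  have b5: "J5 \<Theta> n j = 0" if "n + 2 < j \<or> j + 2 < n" for j
    using assms that by (auto simp: jacobi_type_pencil_def five_diagonal_matrix_def is_banded_def)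
  have z: "pencil_matrix \<Theta> n j = 0" if "n + 2 < j \<or> j + 2 < n" for j
    using b3[of j] b5[of j] that by (auto simp: pencil_matrix_def)
  have e: "pencil_matrix \<Theta> n j = [:J5 \<Theta> n j, - J3 \<Theta> n j:]" for j
    by (simp add: pencil_matrix_def)
  have "matrix_vector (pencil_matrix \<Theta>) p n = (\<Sum>j\<in>{n-2..n+2}. pencil_matrix \<Theta> n j * p j)"
    unfolding matrix_vector_def
  proof (rule sum.mono_neutral_left)
    show "{j. pencil_matrix \<Theta> n j \<noteq> 0} \<subseteq> {n-2..n+2}"
    proof
      fix j assume "j \<in> {j. pencil_matrix \<Theta> n j \<noteq> 0}"
      with z[of j] have "\<not> (n + 2 < j \<or> j + 2 < n)" by blast
      then show "j \<in> {n-2..n+2}" by auto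
    qed
  qed auto
  then have s: "matrix_vector (pencil_matrix \<Theta>) p n =
      (\<Sum>j\<in>{n-2..n+2}. [:J5 \<Theta> n j, - J3 \<Theta> n j:] * p j)"
    by (simp only: e)
  consider "n = 0" | "n = 1" | m where "n = m + 2"
    by (metis One_nat_def add_2_eq_Suc' not0_implies_Suc)
  then show ?thesis
  proof cases
    case 1
    have r: "{n-2..n+2} = {0, 1, 2}" using 1 by auto
    have "J3 \<Theta> 0 2 = 0" using b3[of 2] 1 by simp
    then show ?thesis unfolding s unfolding r using 1 by (simp add: numeral_2_eq_2)
  next
    case 2
    have r: "{n-2..n+2} = {0, 1, 2, 3}" using 2 by auto
    have "J3 \<Theta> 1 3 = 0" using b3[of 3] 2 by simp
    then show ?thesis unfolding s unfolding r using 2 by (simp add: numeral_2_eq_2 numeral_3_eq_3)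
  next
    case 3
    have r: "{n-2..n+2} = {m, m+1, m+2, m+3, m+4}" using 3 by auto
    have q: "n - 1 = m + 1" "n + 1 = m + 3" "n + 2 = m + 4" "n - 2 = m" "n \<ge> 2" "n \<ge> 1"
      using 3 by auto
    have "J3 \<Theta> n m = 0" "J3 \<Theta> n (m + 4) = 0" using b3[of m] b3[of "m+4"] 3 by auto
    then show ?thesis unfolding s unfolding r unfolding q(1-4) using q(5,6) by (simp add: 3 add.assoc)
  qed
qed

end

(* If x^k p_n is expanded in an orthonormal system p, the coefficient matrix is
   (integral of x^k p_i p_j), which is symmetric and banded with half-bandwidth k. Taking k = 1 for
   J3 and k = 2 for J5 (the square of the Jacobi matrix) gives (J5 - x J3) p = x^2 p - x (x p) = 0.
   The inclusion is strict because the pencil of the two 0/1 shift matrices has p_1 = x and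
   p_2 = x^2, so that orthonormality would force both 1 and 0 for the integral of x^2. *)

theory Submission
  imports Defs
begin

lemma matrix_vector_eq_sum:
  assumes "finite S" "\<And>j. j \<notin> S \<Longrightarrow> A n j = 0"
  shows "matrix_vector A v n = (\<Sum>j\<in>S. A n j * v j)"
  unfolding matrix_vector_def
  by (rule sum.mono_neutral_left) (use assms in auto)

text \<open>Induction on \<open>n\<close>: subtracting a multiple of \<open>p (Suc n)\<close>
  cancels the top coefficient and leaves a polynomial of degree at most \<open>n\<close>. Degree 0
  alone would allow \<open>p 0 = 0\<close>, hence the separate hypothesis.\<close>

lemma poly_expansion:
  fixes p :: "nat \<Rightarrow> 'a::field poly"
  assumes "\<And>n. degree (p n) = n" "p 0 \<noteq> 0" "degree q \<le> n"
  shows "\<exists>c. q = (\<Sum>k\<le>n. smult (c k) (p k))"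
  using assms(3)
proof (induction n arbitrary: q)
  case 0
  obtain u where u: "p 0 = [:u:]"
    using assms(1)[of 0] by (metis degree_eq_zeroE)
  obtain v where v: "q = [:v:]"
    using 0 by (metis degree_eq_zeroE le_zero_eq)
  have "q = smult (v / u) (p 0)" using u v assms(2) by simp
  then show ?case by (intro exI[of _ "\<lambda>_. v / u"]) simp
next
  case (Suc n)
  define d where "d = coeff q (Suc n) / coeff (p (Suc n)) (Suc n)"
  have nz: "coeff (p (Suc n)) (Suc n) \<noteq> 0"
    using assms(1)[of "Suc n"] by (metis degree_0 leading_coeff_0_iff nat.distinct(1))
  have "degree (q - smult d (p (Suc n))) \<le> n"
  proof (rule degree_le, intro allI impI)
    fix i assume i: "n < i"
    show "coeff (q - smult d (p (Suc n))) i = 0"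
    proof (cases "i = Suc n")
      case True
      then show ?thesis using nz by (simp add: d_def)
    next
      case False
      then have "degree q < i" "degree (p (Suc n)) < i" using i Suc.prems assms(1) by auto
      then show ?thesis by (simp add: coeff_eq_0)
    qed
  qed
  then obtain c where c: "q - smult d (p (Suc n)) = (\<Sum>k\<le>n. smult (c k) (p k))"
    using Suc.IH by blast
  have "q = (\<Sum>k\<le>Suc n. smult ((c(Suc n := d)) k) (p k))"
    using c by (simp add: algebra_simps)
  then show ?case by blast
qed

text \<open>\<open>L\<close> stands for integration against the orthogonality measure, so the
  algebra below needs only a linear functional on polynomials.\<close>

locale orthonormal_system =
  fixes L :: "real poly \<Rightarrow> real" and p :: "nat \<Rightarrow> real poly"
  assumes L_add: "L (q + r) = L q + L r"
    and L_smult: "L (smult c q) = c * L q"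
    and orthonormal: "L (p n * p m) = (if n = m then 1 else 0)"
    and degree_p: "degree (p n) = n"
    and lead_coeff_pos: "lead_coeff (p n) > 0"
begin

lemma L_sum: "finite S \<Longrightarrow> L (\<Sum>k\<in>S. f k) = (\<Sum>k\<in>S. L (f k))"
proof (induction S rule: finite_induct)
  case empty
  show ?case using L_smult[of 0 0] by simp
qed (simp add: L_add)

lemma L_sum_mult_p:
  "L ((\<Sum>k\<le>n. smult (c k) (p k)) * p m) = (if m \<le> n then c m else 0)"
proof -
  have "L ((\<Sum>k\<le>n. smult (c k) (p k)) * p m) = (\<Sum>k\<le>n. c k * L (p k * p m))"
    by (simp add: sum_distrib_right L_sum L_smult)
  also have "\<dots> = (\<Sum>k\<le>n. if k = m then c k else 0)"
    by (intro sum.cong) (auto simp: orthonormal)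
  finally show ?thesis by simp
qed

text \<open>Some expansion exists because the degrees are 0, 1, 2, ...; pairing it with
  \<open>p k\<close> under \<open>L\<close> identifies its coefficients.\<close>

lemma fourier_expansion:
  assumes "degree q \<le> n"
  shows "q = (\<Sum>k\<le>n. smult (L (q * p k)) (p k))"
proof -
  have "p 0 \<noteq> 0" using lead_coeff_pos[of 0] by auto
  then obtain c where c: "q = (\<Sum>k\<le>n. smult (c k) (p k))"
    using poly_expansion[OF degree_p] assms by blast
  have "L (q * p k) = c k" if "k \<le> n" for k
    using that by (subst c) (simp only: L_sum_mult_p if_True)
  then show ?thesis by (subst c) (intro sum.cong, auto)
qed

text \<open>The expansion of \<open>q\<close> stops at index \<open>degree q\<close>, and
  \<open>p m\<close> is orthogonal to all of its terms.\<close>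

lemma L_mult_p_eq_0:
  assumes "degree q < m"
  shows "L (q * p m) = 0"
proof -
  have "q * p m = (\<Sum>k\<le>degree q. smult (L (q * p k)) (p k)) * p m"
    using fourier_expansion[OF order_refl, of q] by (rule arg_cong)
  also have "L \<dots> = 0" using assms by (simp only: L_sum_mult_p) simp
  finally show ?thesis .
qed

text \<open>Comparing top coefficients in the expansion, where only \<open>p n\<close> reaches
  degree \<open>n\<close>, exhibits the value as a quotient of two positive leading
  coefficients.\<close>

lemma L_mult_p_degree_pos:
  assumes "lead_coeff q > 0"
  shows "L (q * p (degree q)) > 0"
proof -
  define n where "n = degree q"
  have "coeff q n = coeff (\<Sum>k\<le>n. smult (L (q * p k)) (p k)) n"
    using fourier_expansion[of q n] by (simp add: n_def)
  also have "\<dots> = (\<Sum>k\<le>n. if k = n then L (q * p k) * coeff (p k) n else 0)"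
    unfolding coeff_sum by (intro sum.cong) (auto simp: coeff_eq_0 degree_p)
  finally have "coeff q n = L (q * p n) * coeff (p n) n" by simp
  with assms lead_coeff_pos[of n] show ?thesis
    by (simp add: n_def degree_p zero_less_mult_iff)
qed

text \<open>The matrix of multiplication by \<open>monom 1 k\<close> in the basis
  \<open>p\<close>.\<close>

definition moment_matrix :: "nat \<Rightarrow> real inf_matrix" where
  "moment_matrix k i j = L (monom 1 k * p i * p j)"

lemma degree_monom_mult_p: "degree (monom 1 k * p i) = k + i"
proof -
  have "p i \<noteq> 0" using lead_coeff_pos[of i] by auto
  then show ?thesis by (simp add: degree_mult_eq degree_monom_eq degree_p)
qed

lemma moment_matrix_symmetric: "is_symmetric (moment_matrix k)"
  by (simp add: is_symmetric_def moment_matrix_def ac_simps)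

lemma moment_matrix_eq_0: "k + i < j \<Longrightarrow> moment_matrix k i j = 0"
  unfolding moment_matrix_def by (rule L_mult_p_eq_0) (simp add: degree_monom_mult_p)

lemma moment_matrix_banded: "is_banded k (moment_matrix k)"
  unfolding is_banded_def
  by (metis add.commute moment_matrix_eq_0 moment_matrix_symmetric is_symmetric_def)

lemma moment_matrix_pos: "moment_matrix k n (n + k) > 0"
proof -
  have "lead_coeff (monom 1 k * p n) > 0"
    unfolding lead_coeff_mult by (simp add: degree_monom_eq lead_coeff_pos)
  from L_mult_p_degree_pos[OF this] show ?thesis
    by (simp add: moment_matrix_def degree_monom_mult_p add.commute)
qed

text \<open>The upper limit \<open>m\<close> is left free so that the expansions for
  \<open>k = 1\<close> and \<open>k = 2\<close> can be summed over one common range.\<close>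

lemma monom_mult_p_expansion:
  assumes "k + n \<le> m"
  shows "(\<Sum>j\<le>m. smult (moment_matrix k n j) (p j)) = monom 1 k * p n"
  using fourier_expansion[of "monom 1 k * p n" m] assms
  by (simp add: degree_monom_mult_p moment_matrix_def)

lemma in_class_K:
  assumes "p 0 = 1"
  shows "p \<in> class_K"
proof -
  define \<Theta> where "\<Theta> = \<lparr>J3 = moment_matrix 1, J5 = moment_matrix 2,
    alpha = coeff (p 1) 1, beta = coeff (p 1) 0\<rparr>"
  have pencil: "jacobi_type_pencil \<Theta>"
    using moment_matrix_symmetric moment_matrix_banded moment_matrix_pos[of 1]
      moment_matrix_pos[of 2] lead_coeff_pos[of 1]
    by (simp add: \<Theta>_def jacobi_type_pencil_def jacobi_matrix_def five_diagonal_matrix_def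
        degree_p)
  have "p 1 = [:coeff (p 1) 0, coeff (p 1) 1:]"
    by (rule poly_eqI)
      (auto simp: coeff_pCons degree_p intro!: coeff_eq_0 split: nat.splits)
  then have p1: "p 1 = [:beta \<Theta>, alpha \<Theta>:]" by (simp add: \<Theta>_def)
  have "matrix_vector (pencil_matrix \<Theta>) p n = 0" for n
  proof -
    \<comment> \<open>Row \<open>n\<close> vanishes beyond column \<open>n + 2\<close>; the zero
      entries left of the band may stay in the sum.\<close>
    have "matrix_vector (pencil_matrix \<Theta>) p n = (\<Sum>j\<le>n+2. pencil_matrix \<Theta> n j * p j)"
      by (rule matrix_vector_eq_sum)
        (auto simp: pencil_matrix_def \<Theta>_def moment_matrix_eq_0)
    also have "\<dots> = (\<Sum>j\<le>n+2. smult (moment_matrix 2 n j) (p j)) -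
        [:0, 1:] * (\<Sum>j\<le>n+2. smult (moment_matrix 1 n j) (p j))"
      unfolding sum_distrib_left sum_subtractf[symmetric]
      by (intro sum.cong) (auto simp: pencil_matrix_def \<Theta>_def left_diff_distrib)
    also have "\<dots> = monom 1 2 * p n - [:0, 1:] * (monom 1 1 * p n)"
      using monom_mult_p_expansion[of 1 n "n + 2"] monom_mult_p_expansion[of 2 n "n + 2"]
      by (simp only: add.commute[of 2 n])
    also have "\<dots> = 0"
      by (simp add: numeral_2_eq_2 monom_Suc)
    finally show ?thesis .
  qed
  with assms p1 pencil show ?thesis
    unfolding class_K_def associated_system_def by blast
qed

end

text \<open>Finiteness of all moments makes the integral additive on polynomials, as
  \<open>L_add\<close> demands.\<close>

lemma integrable_poly:
  fixes q :: "real poly"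
  assumes "\<And>k. integrable M (\<lambda>x. x ^ k)"
  shows "integrable M (poly q)"
proof -
  have "integrable M (\<lambda>x. \<Sum>i\<le>degree q. coeff q i * x ^ i)"
    using assms by (intro Bochner_Integration.integrable_sum integrable_mult_right) auto
  then show ?thesis by (simp add: poly_altdef[abs_def])
qed

lemma class_R_subset_class_K: "class_R \<subseteq> class_K"
proof
  fix p assume p: "p \<in> class_R"
  then obtain \<sigma> :: "real measure" where
    int: "\<And>k. integrable \<sigma> (\<lambda>x. x ^ k)" and ortho: "orthonormal_wrt \<sigma> p"
    by (auto simp: class_R_def orthonormal_polynomials_def)
  interpret orthonormal_system "\<lambda>q. \<integral>x. poly q x \<partial>\<sigma>" p
    by unfold_locales
      (use p ortho integrable_poly[OF int] in
        \<open>auto simp: class_R_def orthonormal_polynomials_def orthonormal_wrt_def\<close>)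
  show "p \<in> class_K" using p in_class_K by (simp add: class_R_def)
qed

definition shift_pencil :: pencil where
  "shift_pencil = \<lparr>J3 = (\<lambda>i j. if j = i + 1 \<or> i = j + 1 then 1 else 0),
    J5 = (\<lambda>i j. if j = i + 2 \<or> i = j + 2 then 1 else 0), alpha = 1, beta = 0\<rparr>"

text \<open>Row \<open>n\<close> of the pencil equation for \<open>shift_pencil\<close>, solved for
  the entry of index \<open>n + 2\<close>. The guards drop the terms of negative index, which
  truncated subtraction would turn into \<open>shift_system 0\<close>.\<close>

fun shift_system :: "nat \<Rightarrow> real poly" where
  "shift_system 0 = 1"
| "shift_system (Suc 0) = [:0, 1:]"
| "shift_system (Suc (Suc n)) =
    [:0, 1:] * (shift_system (Suc n) + (if n \<ge> 1 then shift_system (n - 1) else 0)) -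
    (if n \<ge> 2 then shift_system (n - 2) else 0)"

lemma shift_system_in_class_K: "shift_system \<in> class_K"
proof -
  have pencil: "jacobi_type_pencil shift_pencil"
    by (auto simp: jacobi_type_pencil_def jacobi_matrix_def five_diagonal_matrix_def
        is_symmetric_def is_banded_def shift_pencil_def)
  have "matrix_vector (pencil_matrix shift_pencil) shift_system n = 0" for n
  proof -
    have rec: "shift_system (n + 2) =
        [:0, 1:] * (shift_system (n + 1) + (if n \<ge> 1 then shift_system (n - 1) else 0)) -
        (if n \<ge> 2 then shift_system (n - 2) else 0)"
      by (simp only: add_2_eq_Suc' Suc_eq_plus1[symmetric] shift_system.simps)
    have J: "J5 shift_pencil n n = 0" "J3 shift_pencil n n = 0"
      "J5 shift_pencil n (n + 1) = 0" "J3 shift_pencil n (n + 1) = 1"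
      "J5 shift_pencil n (n + 2) = 1"
      by (auto simp: shift_pencil_def)
    have J1: "J5 shift_pencil n (n - 1) = 0" "J3 shift_pencil n (n - 1) = 1" if "n \<ge> 1"
      using that by (auto simp: shift_pencil_def)
    have J2: "J5 shift_pencil n (n - 2) = 1" if "n \<ge> 2"
      using that by (auto simp: shift_pencil_def)
    show ?thesis
      unfolding matrix_vector_pencil[OF pencil] rec J
      using J1 J2 by (cases "n \<ge> 1"; cases "n \<ge> 2") (simp_all del: shift_system.simps)
  qed
  then have "associated_system shift_pencil shift_system"
    by (simp add: associated_system_def shift_pencil_def)
  with pencil show ?thesis by (auto simp: class_K_def)
qed

lemma shift_system_notin_class_R: "shift_system \<notin> class_R"
proof
  assume "shift_system \<in> class_R"
  then obtain \<sigma> where ortho: "orthonormal_wrt \<sigma> shift_system"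
    by (auto simp: class_R_def orthonormal_polynomials_def)
  have "(\<integral>x. x * x \<partial>\<sigma>) = 1"
    using ortho[unfolded orthonormal_wrt_def, rule_format, of 1 1] by simp
  moreover have "(\<integral>x. x * x \<partial>\<sigma>) = 0"
    \<comment> \<open>The recurrence at index 0 makes the polynomial of index 2 equal to the square
      of the one of index 1, so its orthogonality to the constant 1 concerns the same
      integral.\<close>
    using ortho[unfolded orthonormal_wrt_def, rule_format, of "Suc (Suc 0)" 0] by simp
  ultimately show False by simp
qed

theorem mainTheorem2:
  shows "class_R \<subseteq> class_K \<and> class_R \<noteq> class_K"
  using class_R_subset_class_K shift_system_in_class_K shift_system_notin_class_R by blast

end
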